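(* Let $U$ and $H$ be real Hilbert spaces and let $G:U\to H$ be a function. For $z\in H$ set $$J:U\to\mathbb{R},\qquad J(u):=\frac12\|u\|_U^2+\frac12\|G(u)-z\|_H^2 .$$ Then the following are equivalent: 1. for every target $z\in H$, $J$ is convex; 2. $G$ is affine.
   Context: No continuity or smoothness of $G$ is assumed. Affine means that $u\mapsto G(u)-G(0)$ is linear (in the algebraic sense). *)

theory Defs
  imports "HOL-Analysis.Analysis"
begin

definition J ::
  "('u::{real_inner,complete_space} \<Rightarrow> 'h::{real_inner,complete_space}) \<Rightarrow> 'h \<Rightarrow> 'u \<Rightarrow> real"
  where "J G z u = 1/2 * (norm u)\<^sup>2 + 1/2 * (norm (G u - z))\<^sup>2"

text \<open>Algebraic affinity: \<open>linear\<close> does not include continuity.\<close>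

definition affine_map :: "('u::real_vector \<Rightarrow> 'h::real_vector) \<Rightarrow> bool"
  where "affine_map G \<longleftrightarrow> linear (\<lambda>u. G u - G 0)"

end

theory Submission
  imports Defs
begin

text \<open>
  Expanding the square, \<open>J G z u\<close> is \<open>- (G u \<bullet> z)\<close> plus a term \<open>f u\<close> not involving \<open>z\<close> plus a term
  independent of \<open>u\<close>. Let \<open>d\<close> be the defect \<open>G ((1 - t) x + t y) - ((1 - t) G x + t G y)\<close>. The
  convexity inequality bounds the defect of \<open>f\<close>, a constant, by \<open>d \<bullet> z\<close>. If this holds for all
  \<open>z\<close>, then \<open>d = 0\<close>, so \<open>G\<close> preserves convex combinations and is therefore affine.
\<close>

text \<open>Expanding both sides in inner products gives an exact identity; its last term is the
  convexity gap, which has a sign for \<open>t\<close> in [0, 1].\<close>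

lemma norm_convex_comb_sq:
  fixes a b :: "'a::real_inner"
  shows "(norm ((1 - t) *\<^sub>R a + t *\<^sub>R b))\<^sup>2
    = (1 - t) * (norm a)\<^sup>2 + t * (norm b)\<^sup>2 - t * (1 - t) * (norm (a - b))\<^sup>2"
  by (simp add: power2_norm_eq_inner inner_add inner_diff inner_commute[of b a] algebra_simps)

lemma convex_on_norm_sq: "convex_on UNIV (\<lambda>a::'a::real_inner. (norm a)\<^sup>2)"
  by (rule convex_onI) (simp_all add: norm_convex_comb_sq)

text \<open>A nonzero linear functional takes arbitrarily negative values, here already along the
  line spanned by \<open>d\<close>.\<close>

lemma inner_bounded_below_imp_zero:
  fixes d :: "'a::real_inner"
  assumes "\<And>z. c \<le> d \<bullet> z"
  shows "d = 0"
proof (rule ccontr)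
  assume "d \<noteq> 0"
  \<comment> \<open>The multiple of \<open>d\<close> is scaled so that the inner product falls
    exactly 1 below the supposed bound \<open>c\<close>.\<close>
  then have "d \<bullet> (((c - 1) / (d \<bullet> d)) *\<^sub>R d) = c - 1"
    by simp
  with assms[of "((c - 1) / (d \<bullet> d)) *\<^sub>R d"] show False
    by simp
qed

lemma affine_map_if_preserves_convex_comb:
  fixes G :: "'u::real_vector \<Rightarrow> 'h::real_vector"
  assumes G: "\<And>t x y. \<lbrakk>0 < t; t < 1\<rbrakk> \<Longrightarrow>
    G ((1 - t) *\<^sub>R x + t *\<^sub>R y) = (1 - t) *\<^sub>R G x + t *\<^sub>R G y"
  shows "affine_map G"
proof -
  define L where "L u = G u - G 0" for u
  have L_comb: "L ((1 - t) *\<^sub>R x + t *\<^sub>R y) = (1 - t) *\<^sub>R L x + t *\<^sub>R L y"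
    if "0 < t" "t < 1" for t x y
    using G[OF that] by (simp add: L_def algebra_simps)
  have L0: "L 0 = 0"
    by (simp add: L_def)
  \<comment> \<open>A combination with the fixed point 0 of \<open>L\<close> is a pure
    scaling.\<close>
  have contract: "L (t *\<^sub>R x) = t *\<^sub>R L x" if "0 < t" "t < 1" for t x
    using L_comb[OF that, of 0 x] L0 by simp
  have scale_pos: "L (r *\<^sub>R x) = r *\<^sub>R L x" if "0 < r" for r x
  proof (cases "r < 1")
    case True
    with that show ?thesis by (rule contract)
  next
    case False
    then consider "r = 1" | "1 < r" by linarith
    then show ?thesis
    proof cases
      case 2
      \<comment> \<open>A factor above 1 is undone by its reciprocal, which lies in (0, 1): contract
        \<open>r *\<^sub>R x\<close> back to \<open>x\<close>.\<close>
      then have "L x = (1 / r) *\<^sub>R L (r *\<^sub>R x)"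
        using contract[of "1 / r" "r *\<^sub>R x"] by simp
      with 2 show ?thesis by simp
    qed simp
  qed
  have add: "L (x + y) = L x + L y" for x y
  proof -
    \<comment> \<open>The sum is the midpoint of the doubled vectors; homogeneity then removes the
      doubling.\<close>
    have "L (x + y) = L ((1 - 1/2) *\<^sub>R (2 *\<^sub>R x) + (1/2) *\<^sub>R (2 *\<^sub>R y))"
      by simp
    also have "\<dots> = (1 - 1/2) *\<^sub>R L (2 *\<^sub>R x) + (1/2) *\<^sub>R L (2 *\<^sub>R y)"
      by (rule L_comb) simp_all
    also have "\<dots> = L x + L y"
      by (simp add: scale_pos)
    finally show ?thesis .
  qed
  have neg: "L (- x) = - L x" for x
    using add[of x "- x"] L0 minus_unique[of "L x" "L (- x)"] by simp
  have "L (r *\<^sub>R x) = r *\<^sub>R L x" for r x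
  proof (cases "0 < r")
    case False
    then show ?thesis
      using scale_pos[of "- r" x] neg[of "r *\<^sub>R x"] L0 by (cases "r = 0") auto
  qed (rule scale_pos)
  with add have "linear L"
    by (rule linearI)
  then show ?thesis
    by (simp add: affine_map_def L_def[abs_def])
qed

lemma affine_map_convex_comb:
  assumes "affine_map G"
  shows "G ((1 - t) *\<^sub>R x + t *\<^sub>R y) = (1 - t) *\<^sub>R G x + t *\<^sub>R G y"
proof -
  interpret linear "\<lambda>u. G u - G 0"
    using assms by (simp add: affine_map_def)
  have "G ((1 - t) *\<^sub>R x + t *\<^sub>R y) - G 0 = (1 - t) *\<^sub>R (G x - G 0) + t *\<^sub>R (G y - G 0)"
    by (simp only: add scale)
  then show ?thesis
    by (simp add: algebra_simps)
qed

text \<open>Both summands are the convex squared norm composed with an affine map: the identity and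
  \<open>G\<close> shifted by \<open>z\<close>.\<close>

lemma convex_on_J_if_affine_map:
  fixes G :: "'u::{real_inner,complete_space} \<Rightarrow> 'h::{real_inner,complete_space}"
  assumes "affine_map G"
  shows "convex_on UNIV (J G z)"
proof (rule convex_onI)
  fix t :: real and x y :: 'u
  assume t: "0 < t" "t < 1"
  let ?w = "(1 - t) *\<^sub>R x + t *\<^sub>R y"
  have "G ?w - z = (1 - t) *\<^sub>R (G x - z) + t *\<^sub>R (G y - z)"
    unfolding affine_map_convex_comb[OF assms] by (simp add: algebra_simps)
  then have "(norm (G ?w - z))\<^sup>2 \<le> (1 - t) * (norm (G x - z))\<^sup>2 + t * (norm (G y - z))\<^sup>2"
    using convex_onD[OF convex_on_norm_sq, of t "G x - z" "G y - z"] t by simp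
  moreover have "(norm ?w)\<^sup>2 \<le> (1 - t) * (norm x)\<^sup>2 + t * (norm y)\<^sup>2"
    using convex_onD[OF convex_on_norm_sq, of t x y] t by simp
  ultimately have "J G z ?w \<le> 1/2 * ((1 - t) * (norm x)\<^sup>2 + t * (norm y)\<^sup>2)
    + 1/2 * ((1 - t) * (norm (G x - z))\<^sup>2 + t * (norm (G y - z))\<^sup>2)"
    unfolding J_def by (intro add_mono mult_left_mono) simp_all
  also have "\<dots> = (1 - t) * J G z x + t * J G z y"
    by (simp add: J_def field_simps)
  finally show "J G z ?w \<le> (1 - t) * J G z x + t * J G z y" .
qed simp

lemma J_expand:
  "J G z u = ((norm u)\<^sup>2 + (norm (G u))\<^sup>2) / 2 - G u \<bullet> z + (norm z)\<^sup>2 / 2"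
  by (simp add: J_def power2_norm_eq_inner inner_diff inner_commute[of z "G u"] field_simps)

lemma affine_map_if_convex_on_J:
  fixes G :: "'u::{real_inner,complete_space} \<Rightarrow> 'h::{real_inner,complete_space}"
  assumes "\<And>z. convex_on UNIV (J G z)"
  shows "affine_map G"
proof (rule affine_map_if_preserves_convex_comb)
  fix t :: real and x y :: 'u
  assume t: "0 < t" "t < 1"
  define w where "w = (1 - t) *\<^sub>R x + t *\<^sub>R y"
  define d where "d = G w - ((1 - t) *\<^sub>R G x + t *\<^sub>R G y)"
  define f where "f u = ((norm u)\<^sup>2 + (norm (G u))\<^sup>2) / 2" for u :: 'u
  have "f w - ((1 - t) * f x + t * f y) \<le> d \<bullet> z" for z
  proof -
    have "J G z w \<le> (1 - t) * J G z x + t * J G z y"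
      using convex_onD[OF assms, of t x y z] t by (simp add: w_def)
    then have "f w - G w \<bullet> z + (norm z)\<^sup>2 / 2
      \<le> (1 - t) * (f x - G x \<bullet> z + (norm z)\<^sup>2 / 2) + t * (f y - G y \<bullet> z + (norm z)\<^sup>2 / 2)"
      by (simp only: J_expand f_def)
    moreover have "d \<bullet> z = G w \<bullet> z - ((1 - t) * (G x \<bullet> z) + t * (G y \<bullet> z))"
      by (simp add: d_def inner_simps)
    \<comment> \<open>The terms in \<open>(norm z)\<^sup>2\<close> cancel because the weights
      \<open>1 - t\<close> and \<open>t\<close> sum to 1.\<close>
    ultimately show ?thesis
      by (simp add: algebra_simps diff_divide_distrib)
  qed
  then have "d = 0"
    by (rule inner_bounded_below_imp_zero)
  then show "G ((1 - t) *\<^sub>R x + t *\<^sub>R y) = (1 - t) *\<^sub>R G x + t *\<^sub>R G y"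
    by (simp add: d_def w_def)
qed

theorem theorem1p4:
  fixes G :: "'u::{real_inner,complete_space} \<Rightarrow> 'h::{real_inner,complete_space}"
  shows "(\<forall>z. convex_on UNIV (J G z)) \<longleftrightarrow> affine_map G"
  using convex_on_J_if_affine_map affine_map_if_convex_on_J by blast

end
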